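(* Consistency alone does not imply disentanglement: there exist a probability space and real-valued square-integrable random variables $U_a, U_e, u_a, u_e$ on it, each with strictly positive variance, such that the pair of estimators $(u_a,u_e)$ satisfies both consistency conditions (C1) and (C2) with respect to $(U_a,U_e)$, but $(u_a,u_e)$ is not disentangled with respect to $(U_a,U_e)$.
   Context: $U_a$ and $U_e$ denote the latent true aleatoric and epistemic uncertainties, and $u_a$ and $u_e$ their respective estimators; all are real-valued square-integrable random variables with strictly positive variance on a common probability space. $\rho(X,Y)=\operatorname{Cov}(X,Y)/\sqrt{\operatorname{Var}(X)\operatorname{Var}(Y)}$ is the Pearson correlation coefficient. The conditions are: Consistency: (C1) $\rho(u_a,U_a)>0$; (C2) $\rho(u_e,U_e)>0$. Orthogonality: (O1) if $\operatorname{Cov}(U_a,U_e)=0$, then $\rho(u_a,U_e)=0$; (O2) if $\operatorname{Cov}(U_a,U_e)=0$, then $\rho(u_e,U_a)=0$. The pair $(u_a,u_e)$ is called disentangled with respect to $(U_a,U_e)$ if and only if all four conditions (C1), (C2), (O1), (O2) hold. *)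

theory Defs
  imports "HOL-Probability.Probability"
begin

context prob_space
begin

definition nondegenerate_L2 :: "('a \<Rightarrow> real) \<Rightarrow> bool" where
  "nondegenerate_L2 X \<longleftrightarrow>
     random_variable borel X \<and> integrable M (\<lambda>\<omega>. (X \<omega>)\<^sup>2) \<and> 0 < variance X"

definition covariance :: "('a \<Rightarrow> real) \<Rightarrow> ('a \<Rightarrow> real) \<Rightarrow> real" where
  "covariance X Y = expectation (\<lambda>\<omega>. (X \<omega> - expectation X) * (Y \<omega> - expectation Y))"

definition correlation :: "('a \<Rightarrow> real) \<Rightarrow> ('a \<Rightarrow> real) \<Rightarrow> real" where
  "correlation X Y = covariance X Y / sqrt (variance X * variance Y)"

text \<open>In the following predicates \<open>Ua\<close>, \<open>Ue\<close> are the latent true aleatoric and epistemic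
  uncertainties, and \<open>ua\<close>, \<open>ue\<close> their respective estimators.\<close>

definition consistent ::
    "('a \<Rightarrow> real) \<Rightarrow> ('a \<Rightarrow> real) \<Rightarrow> ('a \<Rightarrow> real) \<Rightarrow> ('a \<Rightarrow> real) \<Rightarrow> bool" where
  "consistent ua ue Ua Ue \<longleftrightarrow> 0 < correlation ua Ua \<and> 0 < correlation ue Ue"

definition orthogonal ::
    "('a \<Rightarrow> real) \<Rightarrow> ('a \<Rightarrow> real) \<Rightarrow> ('a \<Rightarrow> real) \<Rightarrow> ('a \<Rightarrow> real) \<Rightarrow> bool" where
  "orthogonal ua ue Ua Ue \<longleftrightarrow>
     (covariance Ua Ue = 0 \<longrightarrow> correlation ua Ue = 0) \<and>
     (covariance Ua Ue = 0 \<longrightarrow> correlation ue Ua = 0)"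

definition disentangled ::
    "('a \<Rightarrow> real) \<Rightarrow> ('a \<Rightarrow> real) \<Rightarrow> ('a \<Rightarrow> real) \<Rightarrow> ('a \<Rightarrow> real) \<Rightarrow> bool" where
  "disentangled ua ue Ua Ue \<longleftrightarrow> consistent ua ue Ua Ue \<and> orthogonal ua ue Ua Ue"

end

end

theory Submission
  imports Defs
begin

text \<open>Two independent fair signs \<open>Ua\<close>, \<open>Ue\<close> are uncorrelated, but the single estimator
  \<open>Ua + Ue\<close>, used for both, correlates positively with each of them, so it is consistent
  while violating orthogonality.\<close>

theorem theorem3p1:
  shows "\<exists>(M :: real measure) (Ua :: real \<Rightarrow> real) (Ue :: real \<Rightarrow> real)
           (ua :: real \<Rightarrow> real) (ue :: real \<Rightarrow> real).
           prob_space M \<and>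
           prob_space.nondegenerate_L2 M Ua \<and> prob_space.nondegenerate_L2 M Ue \<and>
           prob_space.nondegenerate_L2 M ua \<and> prob_space.nondegenerate_L2 M ue \<and>
           prob_space.consistent M ua ue Ua Ue \<and>
           \<not> prob_space.disentangled M ua ue Ua Ue"
proof -
  \<comment> \<open>The four equally likely points encode pairs of bits: \<open>Ua\<close> is the
    sign given by the high bit, \<open>Ue\<close> the one given by the low bit, hence their
    independence.\<close>
  define M :: "real measure" where "M = measure_pmf (pmf_of_set {0, 1, 2, 3})"
  define Ua :: "real \<Rightarrow> real" where "Ua x = (if x \<in> {0, 1} then 1 else -1)" for x
  define Ue :: "real \<Rightarrow> real" where "Ue x = (if x \<in> {0, 2} then 1 else -1)" for x
  define u where "u x = Ua x + Ue x" for x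
  interpret prob_space M
    unfolding M_def by (rule prob_space_measure_pmf)
  have E: "expectation f = (f 0 + f 1 + f 2 + f 3) / 4" for f :: "real \<Rightarrow> real"
    by (simp add: M_def integral_pmf_of_set)
  have int: "integrable M f" for f :: "real \<Rightarrow> real"
    unfolding M_def by (rule integrable_measure_pmf_finite) simp
  have var: "variance Ua = 1" "variance Ue = 1" "variance u = 2"
    by (simp_all add: E Ua_def Ue_def u_def)
  have cov: "covariance Ua Ue = 0" "covariance u Ua = 1" "covariance u Ue = 1"
    by (simp_all add: covariance_def E Ua_def Ue_def u_def)
  \<comment> \<open>Measurability, too, comes from \<open>int\<close>, since an integrable function
    is measurable.\<close>
  have "nondegenerate_L2 Ua" "nondegenerate_L2 Ue" "nondegenerate_L2 u"
    by (simp_all add: nondegenerate_L2_def var int borel_measurable_integrable)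
  moreover have "consistent u u Ua Ue"
    by (simp add: consistent_def correlation_def cov var)
  \<comment> \<open>Both orthogonality conditions fail: their premise holds, yet each correlation
    equals \<open>1 / sqrt 2\<close>.\<close>
  moreover have "\<not> disentangled u u Ua Ue"
    by (simp add: disentangled_def orthogonal_def correlation_def cov var)
  ultimately show ?thesis
    using prob_space_axioms by blast
qed

end
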